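(* Let $n\ge1$ be an integer. Then for all $x,x'\in(-1,1)$ with $x\ne x'$, $$\sum_{k=0}^{n-1}\frac{(n+k)\,k!}{(2n+k-1)!}\,{\sf Q}_{k+n-\frac12}^{n-\frac12}(x)\,{\sf Q}_{k+n-\frac12}^{n-\frac12}(x')=\frac{n!}{2(3n-2)!\,(x-x')}\left({\sf Q}_{2n-\frac12}^{n-\frac12}(x)\,{\sf Q}_{2n-\frac32}^{n-\frac12}(x')-{\sf Q}_{2n-\frac32}^{n-\frac12}(x)\,{\sf Q}_{2n-\frac12}^{n-\frac12}(x')\right),$$ and for all $x\in(-1,1)$, $$\sum_{k=0}^{n-1}\frac{(n+k)\,k!}{(2n+k-1)!}\left({\sf Q}_{k+n-\frac12}^{n-\frac12}(x)\right)^2=\frac{n!}{2(3n-2)!\,(1-x^2)}\Big(n\left({\sf Q}_{2n-\frac12}^{n-\frac12}(x)\right)^2+(3n-1)\left({\sf Q}_{2n-\frac32}^{n-\frac12}(x)\right)^2-x(4n-1)\,{\sf Q}_{2n-\frac32}^{n-\frac12}(x)\,{\sf Q}_{2n-\frac12}^{n-\frac12}(x)\Big).$$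
   Context: For $x\in(-1,1)$ the Ferrers function of the first kind is $${\sf P}_\nu^{-\mu}(x)=\left(\frac{1-x}{1+x}\right)^{\frac{\mu}{2}}\sum_{j=0}^\infty\frac{(-\nu)_j(\nu+1)_j}{\Gamma(\mu+1+j)\,j!}\left(\frac{1-x}{2}\right)^j ,$$ with $(a)_0=1$, $(a)_j=a(a+1)\cdots(a+j-1)$ and $1/\Gamma$ the entire reciprocal gamma function, i.e. ${\sf P}_\nu^{-\mu}(x)=\frac{1}{\Gamma(\mu+1)}\left(\frac{1-x}{1+x}\right)^{\mu/2}{}_2F_1\left(-\nu,\nu+1;\mu+1;\frac{1-x}{2}\right)$. The Ferrers function of the second kind is, for $\mu\notin\mathbb Z$, $${\sf Q}_\nu^\mu(x)=\frac{\pi}{2\sin(\pi\mu)}\left(\cos(\pi\mu)\,{\sf P}_\nu^{\mu}(x)-\frac{\Gamma(\nu+\mu+1)}{\Gamma(\nu-\mu+1)}\,{\sf P}_\nu^{-\mu}(x)\right).$$ *)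

theory Defs
  imports "HOL-Analysis.Analysis"
begin

text \<open>
  Ferrers functions for real degree \<open>\<nu>\<close>, real order \<open>\<mu>\<close> and argument \<open>-1 < x < 1\<close>; outside this
  interval the values are junk. The second argument of \<open>ferrers_P\<close> is the superscript itself,
  so the source's formula for the superscript \<open>-\<mu>\<close> appears below with \<open>\<mu>\<close> replaced by \<open>-\<mu>\<close>;
  \<open>ferrers_P_uminus\<close> gives it in its original form. Note that \<open>rGamma\<close> is the entire function
  \<open>1/\<Gamma>\<close>.
\<close>

definition ferrers_P :: "real \<Rightarrow> real \<Rightarrow> real \<Rightarrow> real" where
  "ferrers_P \<nu> \<mu> x =
     ((1 - x) / (1 + x)) powr (- \<mu> / 2) *
     (\<Sum>j. pochhammer (- \<nu>) j * pochhammer (\<nu> + 1) j * rGamma (- \<mu> + 1 + real j) / fact j *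
           ((1 - x) / 2) ^ j)"

lemma ferrers_P_uminus:
  "ferrers_P \<nu> (- \<mu>) x =
     ((1 - x) / (1 + x)) powr (\<mu> / 2) *
     (\<Sum>j. pochhammer (- \<nu>) j * pochhammer (\<nu> + 1) j / (Gamma (\<mu> + 1 + real j) * fact j) *
           ((1 - x) / 2) ^ j)"
  by (simp add: ferrers_P_def rGamma_inverse_Gamma field_simps)

text \<open>
  Meaningful only for \<open>\<mu> \<notin> \<int>\<close>: for integral \<open>\<mu>\<close> the prefactor is a division by zero, and the
  continuous extension in \<open>\<mu>\<close> is not taken.
\<close>

definition ferrers_Q :: "real \<Rightarrow> real \<Rightarrow> real \<Rightarrow> real" where
  "ferrers_Q \<nu> \<mu> x =
     pi / (2 * sin (pi * \<mu>)) *
     (cos (pi * \<mu>) * ferrers_P \<nu> \<mu> x -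
      Gamma (\<nu> + \<mu> + 1) / Gamma (\<nu> - \<mu> + 1) * ferrers_P \<nu> (- \<mu>) x)"

end

theory Submission
  imports Defs "HOL-Real_Asymp.Real_Asymp"
begin

text \<open>
  Put \<open>\<mu> = n - 1/2\<close>. Since \<open>cos (\<pi> \<mu>) = 0\<close>, the function \<open>ferrers_Q (\<mu> + k) \<mu>\<close> is the multiple
  \<open>(2n + k - 1)! / k!\<close> of \<open>ferrers_P (\<mu> + k) (- \<mu>)\<close>, up to a constant factor that does not depend
  on \<open>k\<close> or \<open>x\<close> (\<open>ferrers_Q_half_integer_order\<close>). Comparing coefficients of the hypergeometric series
  gives the three-term recurrence in the degree for \<open>ferrers_P\<close> (\<open>ferrers_P_recurrence\<close>), hence one
  for \<open>q k = ferrers_Q (\<mu> + k) \<mu> x\<close>. At degree \<open>\<mu> + k\<close> the coefficient of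
  \<open>ferrers_P (\<mu> + k - 1) (- \<mu>)\<close> is \<open>k\<close>, so that the recurrence starts at \<open>k = 0\<close> with an equation
  between \<open>q 0\<close> and \<open>q 1\<close> alone, as for a sequence of orthogonal polynomials (indeed \<open>q\<close> consists
  of Gegenbauer polynomials, up to a factor independent of \<open>k\<close>).

  The first formula is then the Christoffel-Darboux summation: the recurrence makes the summands
  times \<open>x - x'\<close> telescope (\<open>christoffel_darboux\<close>). The second formula is its limit as \<open>x'\<close> tends
  to \<open>x\<close>, with the derivatives expressed through \<open>q\<close> itself. No derivative is needed to prove
  it, however: after multiplication by \<open>1 - x\<^sup>2\<close> its summands telescope by the recurrence alone
  (\<open>christoffel_darboux_diagonal\<close>).
\<close>

section \<open>Recurrence in the degree for Ferrers functions of the first kind\<close>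

text \<open>The coefficient of \<open>((1 - x) / 2) ^ j\<close> in the series that defines \<open>ferrers_P \<nu> \<mu> x\<close>.\<close>

definition ferrers_coeff :: "real \<Rightarrow> real \<Rightarrow> nat \<Rightarrow> real" where
  "ferrers_coeff \<nu> \<mu> j =
     pochhammer (- \<nu>) j * pochhammer (\<nu> + 1) j * rGamma (- \<mu> + 1 + real j) / fact j"

lemma ferrers_P_eq_suminf:
  "ferrers_P \<nu> \<mu> x =
     ((1 - x) / (1 + x)) powr (- \<mu> / 2) * (\<Sum>j. ferrers_coeff \<nu> \<mu> j * ((1 - x) / 2) ^ j)"
  by (simp add: ferrers_P_def ferrers_coeff_def)

lemma ferrers_coeff_Suc:
  "(real j + 1) * (real j + 1 - \<mu>) * ferrers_coeff \<nu> \<mu> (Suc j) =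
     (real j - \<nu>) * (real j + \<nu> + 1) * ferrers_coeff \<nu> \<mu> j"
proof -
  have "rGamma (- \<mu> + 1 + real j) = (real j + 1 - \<mu>) * rGamma (- \<mu> + 1 + real (Suc j))"
    using rGamma_plus1[of "- \<mu> + 1 + real j"] by (simp add: algebra_simps)
  then show ?thesis
    by (simp add: ferrers_coeff_def pochhammer_rec' divide_simps) (simp add: algebra_simps)
qed

lemma summable_ferrers_coeff:
  assumes "\<bar>z\<bar> < 1"
  shows "summable (\<lambda>j. ferrers_coeff \<nu> \<mu> j * z ^ j)"
proof -
  define r where "r = (1 + \<bar>z\<bar>) / 2"
  have r: "r < 1" "\<bar>z\<bar> < r" using assms by (auto simp: r_def)
  have "((\<lambda>j. \<bar>(real j - \<nu>) * (real j + \<nu> + 1)\<bar> / ((real j + 1) * (real j + 1 - \<mu>)) * \<bar>z\<bar>)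
          \<longlongrightarrow> 1 * \<bar>z\<bar>) sequentially"
    by (intro tendsto_mult tendsto_const) real_asymp
  then have "\<forall>\<^sub>F j in sequentially.
      \<bar>(real j - \<nu>) * (real j + \<nu> + 1)\<bar> / ((real j + 1) * (real j + 1 - \<mu>)) * \<bar>z\<bar> < r"
    using r by (intro order_tendstoD(2)) auto
  moreover have "\<forall>\<^sub>F j in sequentially. real j + 1 - \<mu> > 0" by real_asymp
  ultimately have "\<forall>\<^sub>F j in sequentially.
      \<bar>ferrers_coeff \<nu> \<mu> (Suc j) * z ^ Suc j\<bar> \<le> r * \<bar>ferrers_coeff \<nu> \<mu> j * z ^ j\<bar>"
  proof eventually_elim
    case (elim j)
    let ?q = "(real j - \<nu>) * (real j + \<nu> + 1) / ((real j + 1) * (real j + 1 - \<mu>))"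
    have "ferrers_coeff \<nu> \<mu> (Suc j) = ?q * ferrers_coeff \<nu> \<mu> j"
      using ferrers_coeff_Suc[of j \<mu> \<nu>] elim(2)
      by (simp add: nonzero_eq_divide_eq mult_ac)
    then have "\<bar>ferrers_coeff \<nu> \<mu> (Suc j) * z ^ Suc j\<bar>
        = (\<bar>?q\<bar> * \<bar>z\<bar>) * \<bar>ferrers_coeff \<nu> \<mu> j * z ^ j\<bar>"
      by (simp add: abs_mult)
    moreover have "\<bar>?q\<bar> * \<bar>z\<bar> < r"
      using elim by (simp add: abs_mult)
    ultimately show ?case
      by (metis abs_ge_zero less_imp_le mult_right_mono)
  qed
  then obtain N where "\<And>j. j \<ge> N \<Longrightarrow>
      \<bar>ferrers_coeff \<nu> \<mu> (Suc j) * z ^ Suc j\<bar> \<le> r * \<bar>ferrers_coeff \<nu> \<mu> j * z ^ j\<bar>"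
    by (auto simp: eventually_sequentially)
  then show ?thesis
    using r(1) by (intro summable_ratio_test[where c = r and N = N]) auto
qed

lemma ferrers_coeff_recurrence_0:
  "(\<nu> - \<mu> + 1) * ferrers_coeff (\<nu> + 1) \<mu> 0 - (2 * \<nu> + 1) * ferrers_coeff \<nu> \<mu> 0
     + (\<nu> + \<mu>) * ferrers_coeff (\<nu> - 1) \<mu> 0 = 0"
  by (simp add: ferrers_coeff_def algebra_simps)

text \<open>
  The coefficient of \<open>z ^ Suc j\<close> in the three-term recurrence, where \<open>x = 1 - 2 z\<close>. All four
  coefficients are polynomial multiples of
  \<open>(-\<nu>)\<^sub>j (\<nu> + 1)\<^sub>j rGamma (j + 2 - \<mu>) / (j + 1)!\<close>, and the polynomials satisfy the identity.
\<close>

lemma ferrers_coeff_recurrence_Suc: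
  "(\<nu> - \<mu> + 1) * ferrers_coeff (\<nu> + 1) \<mu> (Suc j)
     - (2 * \<nu> + 1) * (ferrers_coeff \<nu> \<mu> (Suc j) - 2 * ferrers_coeff \<nu> \<mu> j)
     + (\<nu> + \<mu>) * ferrers_coeff (\<nu> - 1) \<mu> (Suc j) = 0"
proof -
  define A where "A = pochhammer (- \<nu>) j"
  define B where "B = pochhammer (\<nu> + 1) j"
  define R where "R = rGamma (- \<mu> + 1 + real (Suc j)) / fact (Suc j)"
  have up: "pochhammer (- (\<nu> + 1)) (Suc j) * pochhammer (\<nu> + 1 + 1) (Suc j)
      = - (A * B * (\<nu> + 1 + real j) * (\<nu> + 2 + real j))"
  proof -
    have "pochhammer (- (\<nu> + 1)) (Suc j) = - (\<nu> + 1) * A"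
      by (simp add: A_def pochhammer_rec)
    moreover have "(\<nu> + 1) * pochhammer (\<nu> + 1 + 1) (Suc j)
        = B * (\<nu> + 1 + real j) * (\<nu> + 2 + real j)"
      using pochhammer_rec[of "\<nu> + 1" "Suc j"]
      by (simp add: B_def pochhammer_Suc algebra_simps)
    ultimately show ?thesis by algebra
  qed
  have mid: "pochhammer (- \<nu>) (Suc j) * pochhammer (\<nu> + 1) (Suc j)
      = A * B * (real j - \<nu>) * (\<nu> + 1 + real j)"
    by (simp add: A_def B_def pochhammer_Suc)
  have down: "pochhammer (- (\<nu> - 1)) (Suc j) * pochhammer (\<nu> - 1 + 1) (Suc j)
      = - (A * B * (real j - \<nu>) * (real j + 1 - \<nu>))"
  proof -
    have "pochhammer (\<nu> - 1 + 1) (Suc j) = \<nu> * B"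
      by (simp add: B_def pochhammer_rec)
    moreover have "- \<nu> * pochhammer (- (\<nu> - 1)) (Suc j)
        = A * (real j - \<nu>) * (real j + 1 - \<nu>)"
      using pochhammer_rec[of "- \<nu>" "Suc j"]
      by (simp add: A_def pochhammer_Suc algebra_simps)
    ultimately show ?thesis by algebra
  qed
  have gamma: "rGamma (- \<mu> + 1 + real j) = (real j + 1 - \<mu>) * rGamma (- \<mu> + 1 + real (Suc j))"
    using rGamma_plus1[of "- \<mu> + 1 + real j"] by (simp add: algebra_simps)
  have "rGamma (- \<mu> + 1 + real (Suc j)) = fact j * (real j + 1) * R"
    unfolding R_def fact_Suc by (simp add: divide_simps)
  then have low: "ferrers_coeff \<nu> \<mu> j = A * B * (real j + 1) * (real j + 1 - \<mu>) * R"
    unfolding ferrers_coeff_def A_def[symmetric] B_def[symmetric] gamma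
    by simp
  have coeffs:
    "ferrers_coeff (\<nu> + 1) \<mu> (Suc j) = - (A * B * (\<nu> + 1 + real j) * (\<nu> + 2 + real j)) * R"
    "ferrers_coeff \<nu> \<mu> (Suc j) = A * B * (real j - \<nu>) * (\<nu> + 1 + real j) * R"
    "ferrers_coeff (\<nu> - 1) \<mu> (Suc j) = - (A * B * (real j - \<nu>) * (real j + 1 - \<nu>)) * R"
    unfolding ferrers_coeff_def up mid down by (simp_all add: R_def)
  show ?thesis unfolding coeffs low by algebra
qed

lemma ferrers_P_recurrence:
  assumes "-1 < x" "x < 1"
  shows "(\<nu> - \<mu> + 1) * ferrers_P (\<nu> + 1) \<mu> x - (2 * \<nu> + 1) * x * ferrers_P \<nu> \<mu> x
           + (\<nu> + \<mu>) * ferrers_P (\<nu> - 1) \<mu> x = 0"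
proof -
  define z where "z = (1 - x) / 2"
  have z: "\<bar>z\<bar> < 1" and x: "x = 1 - 2 * z"
    using assms by (auto simp: z_def abs_if diff_divide_distrib)
  define S where "S = (\<lambda>\<nu>. \<Sum>j. ferrers_coeff \<nu> \<mu> j * z ^ j)"
  have S: "(\<lambda>j. ferrers_coeff \<nu> \<mu> j * z ^ j) sums S \<nu>" for \<nu>
    unfolding S_def by (intro summable_sums summable_ferrers_coeff z)
  have shifted: "(\<lambda>j. ferrers_coeff \<nu> \<mu> (Suc j) * z ^ Suc j) sums (S \<nu> - ferrers_coeff \<nu> \<mu> 0)" for \<nu>
    using S[of \<nu>] sums_Suc_iff[of "\<lambda>j. ferrers_coeff \<nu> \<mu> j * z ^ j" "S \<nu> - ferrers_coeff \<nu> \<mu> 0"]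
    by simp
  have lim: "(\<lambda>j. (\<nu> - \<mu> + 1) * (ferrers_coeff (\<nu> + 1) \<mu> (Suc j) * z ^ Suc j)
      - (2 * \<nu> + 1) * (ferrers_coeff \<nu> \<mu> (Suc j) * z ^ Suc j
          - 2 * z * (ferrers_coeff \<nu> \<mu> j * z ^ j))
      + (\<nu> + \<mu>) * (ferrers_coeff (\<nu> - 1) \<mu> (Suc j) * z ^ Suc j))
    sums ((\<nu> - \<mu> + 1) * (S (\<nu> + 1) - ferrers_coeff (\<nu> + 1) \<mu> 0)
      - (2 * \<nu> + 1) * ((S \<nu> - ferrers_coeff \<nu> \<mu> 0) - 2 * z * S \<nu>)
      + (\<nu> + \<mu>) * (S (\<nu> - 1) - ferrers_coeff (\<nu> - 1) \<mu> 0))"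
    by (intro sums_add sums_diff sums_mult shifted S)
  have zero: "(\<nu> - \<mu> + 1) * (ferrers_coeff (\<nu> + 1) \<mu> (Suc j) * z ^ Suc j)
      - (2 * \<nu> + 1) * (ferrers_coeff \<nu> \<mu> (Suc j) * z ^ Suc j
          - 2 * z * (ferrers_coeff \<nu> \<mu> j * z ^ j))
      + (\<nu> + \<mu>) * (ferrers_coeff (\<nu> - 1) \<mu> (Suc j) * z ^ Suc j) = 0" for j
  proof -
    define w where "w = z ^ j"
    show ?thesis
      using ferrers_coeff_recurrence_Suc[of \<nu> \<mu> j]
      unfolding power_Suc w_def[symmetric] by algebra
  qed
  have "(\<nu> - \<mu> + 1) * (S (\<nu> + 1) - ferrers_coeff (\<nu> + 1) \<mu> 0)
      - (2 * \<nu> + 1) * ((S \<nu> - ferrers_coeff \<nu> \<mu> 0) - 2 * z * S \<nu>)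
      + (\<nu> + \<mu>) * (S (\<nu> - 1) - ferrers_coeff (\<nu> - 1) \<mu> 0) = 0"
    by (rule sums_unique2[OF lim[unfolded zero] sums_zero])
  then have rec: "(\<nu> - \<mu> + 1) * S (\<nu> + 1) - (2 * \<nu> + 1) * x * S \<nu> + (\<nu> + \<mu>) * S (\<nu> - 1) = 0"
    using ferrers_coeff_recurrence_0[of \<nu> \<mu>] unfolding x by algebra
  have P: "ferrers_P \<nu> \<mu> x = ((1 - x) / (1 + x)) powr (- \<mu> / 2) * S \<nu>" for \<nu>
    by (simp add: ferrers_P_eq_suminf z_def S_def)
  show ?thesis
    unfolding P using rec by algebra
qed

section \<open>Ferrers functions of the second kind of half-integer order\<close>

lemma cos_pi_half_integer: "cos (pi * (real n - 1 / 2)) = 0"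
  by (simp add: right_diff_distrib cos_diff mult.commute)

lemma ferrers_Q_half_integer_order:
  assumes "n \<ge> 1"
  shows "ferrers_Q (real k + real n - 1 / 2) (real n - 1 / 2) x =
    - (pi / (2 * sin (pi * (real n - 1 / 2)))) * (fact (2 * n - 1 + k) / fact k) *
      ferrers_P (real k + real n - 1 / 2) (- (real n - 1 / 2)) x"
proof -
  have "real k + real n - 1 / 2 + (real n - 1 / 2) + 1 = 1 + real (2 * n - 1 + k)"
    using assms by (simp add: of_nat_diff)
  then have "Gamma (real k + real n - 1 / 2 + (real n - 1 / 2) + 1) = fact (2 * n - 1 + k)"
    by (simp only: Gamma_fact)
  moreover have "Gamma (real k + real n - 1 / 2 - (real n - 1 / 2) + 1) = fact k"
    using Gamma_fact[of k] by (simp add: add.commute)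
  ultimately show ?thesis
    unfolding ferrers_Q_def cos_pi_half_integer by simp
qed

text \<open>
  The recurrence in \<open>k\<close> satisfied by the sequence \<open>k \<mapsto> ferrers_Q (k + n - 1/2) (n - 1/2) x\<close>, with
  \<open>m = 2 n - 1\<close>. The first clause is the second one continued to \<open>k = -1\<close>, without the term \<open>q (-1)\<close>.
\<close>

definition ultraspherical_recurrence :: "nat \<Rightarrow> real \<Rightarrow> (nat \<Rightarrow> real) \<Rightarrow> bool" where
  "ultraspherical_recurrence m x q \<longleftrightarrow>
     q 1 = (real m + 1) * x * q 0 \<and>
     (\<forall>k. (real k + 2) * q (k + 2) =
        (real m + 2 * real k + 3) * x * q (k + 1) - (real m + real k + 1) * q k)"

lemma ferrers_Q_recurrence:
  assumes "n \<ge> 1" "-1 < x" "x < 1"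
  shows "ultraspherical_recurrence (2 * n - 1) x
           (\<lambda>k. ferrers_Q (real k + real n - 1 / 2) (real n - 1 / 2) x)"
proof -
  define m where "m = 2 * n - 1"
  have m: "real m = 2 * real n - 1" using assms by (simp add: m_def of_nat_diff)
  \<comment> \<open>indexed by integers, since the recurrence at degree \<open>n - 1/2\<close> involves \<open>p (-1)\<close>\<close>
  define p where "p = (\<lambda>k::int. ferrers_P (of_int k + real n - 1 / 2) (- (real n - 1 / 2)) x)"
  define c where "c = - (pi / (2 * sin (pi * (real n - 1 / 2))))"
  have Q: "ferrers_Q (real k + real n - 1 / 2) (real n - 1 / 2) x
      = c * (fact (m + k) / fact k) * p (int k)" for k
    using ferrers_Q_half_integer_order[OF assms(1), of k x] by (simp add: c_def p_def m_def)
  have P: "(of_int k + real m + 1) * p (k + 1)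
      = (2 * of_int k + real m + 1) * x * p k - of_int k * p (k - 1)" for k
    using ferrers_P_recurrence[OF assms(2,3),
        of "of_int k + real n - 1 / 2" "- (real n - 1 / 2)"]
    by (simp add: p_def m algebra_simps)
  have "p 1 = x * p 0"
    using P[of 0] by simp
  then have "ferrers_Q (real 1 + real n - 1 / 2) (real n - 1 / 2) x =
      (real m + 1) * x * ferrers_Q (real 0 + real n - 1 / 2) (real n - 1 / 2) x"
    unfolding Q by (simp add: algebra_simps)
  moreover have "(real k + 2) * ferrers_Q (real (k + 2) + real n - 1 / 2) (real n - 1 / 2) x =
      (real m + 2 * real k + 3) * x * ferrers_Q (real (k + 1) + real n - 1 / 2) (real n - 1 / 2) x
      - (real m + real k + 1) * ferrers_Q (real k + real n - 1 / 2) (real n - 1 / 2) x" for k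
  proof -
    define F where "F = c * (fact (m + k + 1) / fact (k + 1))"
    have "c * (fact (m + (k + 2)) / fact (k + 2)) * (real k + 2) = F * (real m + real k + 2)"
      "c * (fact (m + (k + 1)) / fact (k + 1)) = F"
      "c * (fact (m + k) / fact k) * (real m + real k + 1) = F * (real k + 1)"
      by (simp_all add: F_def divide_simps) (simp_all add: algebra_simps)
    moreover have "(real m + real k + 2) * p (int (k + 2))
        = (2 * real k + real m + 3) * x * p (int (k + 1)) - (real k + 1) * p (int k)"
      using P[of "int k + 1"] by (simp add: algebra_simps)
    ultimately show ?thesis
      unfolding Q by algebra
  qed
  ultimately show ?thesis
    unfolding ultraspherical_recurrence_def m_def[symmetric] by blast
qed

section \<open>Christoffel-Darboux summation\<close>

lemma fact_quotient_shift:
  "fact (N + 1) / fact (m + N) = fact (N + 1) / fact (m + N + 1) * (real m + real N + 1)"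
  "fact (N + 2) / fact (m + N + 1) = fact (N + 1) / fact (m + N + 1) * (real N + 2)"
proof -
  have "fact (m + N + 1) = (real m + real N + 1) * fact (m + N)"
    by (simp add: algebra_simps)
  moreover have "real m + real N + 1 \<noteq> 0"
    by linarith
  ultimately show "fact (N + 1) / fact (m + N) =
      fact (N + 1) / fact (m + N + 1) * (real m + real N + 1)"
    by (simp only: divide_simps) simp
  have "fact (N + 2) = (real N + 2) * fact (N + 1)"
    by (simp add: algebra_simps)
  then show "fact (N + 2) / fact (m + N + 1) =
      fact (N + 1) / fact (m + N + 1) * (real N + 2)"
    by (simp only: times_divide_eq_left) (simp only: mult.commute)
qed

lemma christoffel_darboux:
  assumes "ultraspherical_recurrence m x q" "ultraspherical_recurrence m y r"
  shows "(x - y) * (\<Sum>k=0..N. (real m + 1 + 2 * real k) * fact k / fact (m + k) * q k * r k) =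
           fact (N + 1) / fact (m + N) * (q (N + 1) * r N - q N * r (N + 1))"
proof (induction N)
  case 0
  then show ?case
    using assms by (simp add: ultraspherical_recurrence_def divide_simps) (simp add: algebra_simps)
next
  case (Suc N)
  define F where "F = fact (N + 1) / (fact (m + N + 1) :: real)"
  have F: "fact (N + 1) / fact (m + N) = F * (real m + real N + 1)"
    "fact (Suc N) / fact (m + Suc N) = F"
    "fact (Suc N + 1) / fact (m + Suc N) = F * (real N + 2)"
    using fact_quotient_shift[of N m] by (simp_all add: F_def)
  have rec: "(real N + 2) * q (N + 2) =
        (real m + 2 * real N + 3) * x * q (N + 1) - (real m + real N + 1) * q N"
    "(real N + 2) * r (N + 2) =
        (real m + 2 * real N + 3) * y * r (N + 1) - (real m + real N + 1) * r N"
    using assms by (auto simp: ultraspherical_recurrence_def)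
  have "(x - y) * (\<Sum>k=0..Suc N. (real m + 1 + 2 * real k) * fact k / fact (m + k) * q k * r k)
      = F * (real m + real N + 1) * (q (N + 1) * r N - q N * r (N + 1))
        + (x - y) * ((real m + 2 * real N + 3) * F * q (N + 1) * r (N + 1))"
  proof -
    define T where "T = (\<Sum>k=0..N. (real m + 1 + 2 * real k) * fact k / fact (m + k) * q k * r k)"
    have "(\<Sum>k=0..Suc N. (real m + 1 + 2 * real k) * fact k / fact (m + k) * q k * r k)
        = T + (real m + 2 * real N + 3) * F * q (N + 1) * r (N + 1)"
      unfolding T_def sum.atLeast0_atMost_Suc times_divide_eq_right[symmetric] F(2) by simp
    then show ?thesis
      using Suc.IH[folded T_def, unfolded F(1)] by algebra
  qed
  also have "\<dots> = F * (real N + 2) * (q (N + 2) * r (N + 1) - q (N + 1) * r (N + 2))"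
    using rec by algebra
  finally show ?case
    unfolding F(3) by simp
qed

text \<open>
  Both sides can be compared term by term: by the recurrence, the right-hand side for \<open>N + 1\<close> minus
  that for \<open>N\<close> is \<open>1 - x\<^sup>2\<close> times a multiple of \<open>(q (N + 1))\<^sup>2\<close>.
\<close>

lemma christoffel_darboux_diagonal:
  assumes "ultraspherical_recurrence m x q"
  shows "(1 - x\<^sup>2) * (\<Sum>k=0..N. (real m + 1 + 2 * real k) * fact k / fact (m + k) * (q k)\<^sup>2) =
           fact (N + 1) / fact (m + N) *
             ((real N + 1) * (q (N + 1))\<^sup>2 + (real m + real N + 1) * (q N)\<^sup>2
               - (real m + 2 * real N + 2) * x * q N * q (N + 1))"
proof (induction N)
  case 0
  have "q 1 = (real m + 1) * x * q 0"
    using assms by (simp add: ultraspherical_recurrence_def)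
  then have "(1 - x\<^sup>2) * ((real m + 1) * (q 0)\<^sup>2)
      = (q 1)\<^sup>2 + (real m + 1) * (q 0)\<^sup>2 - (real m + 2) * x * q 0 * q 1"
    by algebra
  then show ?case
    by (simp add: divide_simps)
next
  case (Suc N)
  define F where "F = fact (N + 1) / (fact (m + N + 1) :: real)"
  have F: "fact (N + 1) / fact (m + N) = F * (real m + real N + 1)"
    "fact (Suc N) / fact (m + Suc N) = F"
    "fact (Suc N + 1) / fact (m + Suc N) = F * (real N + 2)"
    using fact_quotient_shift[of N m] by (simp_all add: F_def)
  have rec: "(real N + 2) * q (N + 2) =
        (real m + 2 * real N + 3) * x * q (N + 1) - (real m + real N + 1) * q N"
    using assms by (auto simp: ultraspherical_recurrence_def)
  have "(1 - x\<^sup>2) * (\<Sum>k=0..Suc N. (real m + 1 + 2 * real k) * fact k / fact (m + k) * (q k)\<^sup>2)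
      = F * (real m + real N + 1) *
          ((real N + 1) * (q (N + 1))\<^sup>2 + (real m + real N + 1) * (q N)\<^sup>2
               - (real m + 2 * real N + 2) * x * q N * q (N + 1))
        + (1 - x\<^sup>2) * ((real m + 2 * real N + 3) * F * (q (N + 1))\<^sup>2)"
  proof -
    define T where "T = (\<Sum>k=0..N. (real m + 1 + 2 * real k) * fact k / fact (m + k) * (q k)\<^sup>2)"
    have "(\<Sum>k=0..Suc N. (real m + 1 + 2 * real k) * fact k / fact (m + k) * (q k)\<^sup>2)
        = T + (real m + 2 * real N + 3) * F * (q (N + 1))\<^sup>2"
      unfolding T_def sum.atLeast0_atMost_Suc times_divide_eq_right[symmetric] F(2) by simp
    then show ?thesis
      using Suc.IH[folded T_def, unfolded F(1)] by algebra
  qed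
  also have "\<dots> = F * (real N + 2) *
      ((real N + 2) * (q (N + 2))\<^sup>2 + (real m + real N + 2) * (q (N + 1))\<^sup>2
        - (real m + 2 * real N + 4) * x * q (N + 1) * q (N + 2))"
    using rec by algebra
  finally show ?case
    unfolding F(3) by (simp add: add_ac)
qed

section \<open>Sums of products of Ferrers functions of the second kind\<close>

theorem corollary3p14:
  fixes n :: nat
  assumes "n \<ge> 1"
  shows
    "(\<forall>x\<in>{-1<..<1}. \<forall>x'\<in>{-1<..<1}. x \<noteq> x' \<longrightarrow>
       (\<Sum>k=0..n-1. (real n + real k) * fact k / fact (2 * n + k - 1) *
          ferrers_Q (real k + real n - 1/2) (real n - 1/2) x *
          ferrers_Q (real k + real n - 1/2) (real n - 1/2) x') =
       fact n / (2 * fact (3 * n - 2) * (x - x')) *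
         (ferrers_Q (2 * real n - 1/2) (real n - 1/2) x *
            ferrers_Q (2 * real n - 3/2) (real n - 1/2) x' -
          ferrers_Q (2 * real n - 3/2) (real n - 1/2) x *
            ferrers_Q (2 * real n - 1/2) (real n - 1/2) x')) \<and>
    (\<forall>x\<in>{-1<..<1}.
       (\<Sum>k=0..n-1. (real n + real k) * fact k / fact (2 * n + k - 1) *
          (ferrers_Q (real k + real n - 1/2) (real n - 1/2) x)\<^sup>2) =
       fact n / (2 * fact (3 * n - 2) * (1 - x\<^sup>2)) *
         (real n * (ferrers_Q (2 * real n - 1/2) (real n - 1/2) x)\<^sup>2 +
          (3 * real n - 1) * (ferrers_Q (2 * real n - 3/2) (real n - 1/2) x)\<^sup>2 -
          x * (4 * real n - 1) * ferrers_Q (2 * real n - 3/2) (real n - 1/2) x *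
            ferrers_Q (2 * real n - 1/2) (real n - 1/2) x))"
proof -
  define m where "m = 2 * n - 1"
  define N where "N = n - 1"
  define q where "q = (\<lambda>x k. ferrers_Q (real k + real n - 1 / 2) (real n - 1 / 2) x)"
  have m: "real m = 2 * real n - 1" and N: "N + 1 = n" "real N = real n - 1"
    using assms by (auto simp: m_def N_def of_nat_diff)
  have idx: "m + k = 2 * n + k - 1" "m + N = 3 * n - 2" for k
    using assms by (auto simp: m_def N_def)
  have weight: "(real m + 1 + 2 * real k) * fact k / fact (m + k)
      = 2 * ((real n + real k) * fact k / fact (2 * n + k - 1))" for k
    unfolding m idx by (simp add: algebra_simps add_divide_distrib)
  have top: "ferrers_Q (2 * real n - 1 / 2) (real n - 1 / 2) x = q x n"
    "ferrers_Q (2 * real n - 3 / 2) (real n - 1 / 2) x = q x N" for x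
    by (simp_all add: q_def N(2) algebra_simps)
  have rec: "ultraspherical_recurrence m x (q x)" if "x \<in> {-1<..<1}" for x
    unfolding m_def q_def using that assms by (intro ferrers_Q_recurrence) auto
  have off: "(\<Sum>k=0..N. (real n + real k) * fact k / fact (2 * n + k - 1) * q x k * q x' k) =
      fact n / (2 * fact (3 * n - 2) * (x - x')) * (q x n * q x' N - q x N * q x' n)"
    if "x \<in> {-1<..<1}" "x' \<in> {-1<..<1}" "x \<noteq> x'" for x x'
  proof -
    have "(x - x') * (2 * (\<Sum>k=0..N. (real n + real k) * fact k / fact (2 * n + k - 1) * q x k * q x' k))
        = fact n / fact (3 * n - 2) * (q x n * q x' N - q x N * q x' n)"
      using christoffel_darboux[OF rec[OF that(1)] rec[OF that(2)], of N]
      unfolding weight N(1) idx(2) by (simp add: sum_distrib_left mult.assoc)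
    then show ?thesis
      using that(3) by (simp add: divide_simps mult_ac)
  qed
  have diag: "(\<Sum>k=0..N. (real n + real k) * fact k / fact (2 * n + k - 1) * (q x k)\<^sup>2) =
      fact n / (2 * fact (3 * n - 2) * (1 - x\<^sup>2)) *
        (real n * (q x n)\<^sup>2 + (3 * real n - 1) * (q x N)\<^sup>2 - x * (4 * real n - 1) * q x N * q x n)"
    if "x \<in> {-1<..<1}" for x
  proof -
    have "x\<^sup>2 < 1" using that by (auto simp: abs_square_less_1)
    have coeffs: "real N + 1 = real n" "real m + real N + 1 = 3 * real n - 1"
      "(real m + 2 * real N + 2) * x = x * (4 * real n - 1)"
      by (simp_all add: m N algebra_simps)
    have "(1 - x\<^sup>2) * (2 * (\<Sum>k=0..N. (real n + real k) * fact k / fact (2 * n + k - 1) * (q x k)\<^sup>2))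
        = fact n / fact (3 * n - 2) * (real n * (q x n)\<^sup>2 + (3 * real n - 1) * (q x N)\<^sup>2
            - x * (4 * real n - 1) * q x N * q x n)"
      using christoffel_darboux_diagonal[OF rec[OF that], of N]
      unfolding coeffs weight N(1) idx(2) by (simp only: sum_distrib_left mult.assoc)
    then show ?thesis
      using \<open>x\<^sup>2 < 1\<close> by (simp add: divide_simps mult_ac)
  qed
  show ?thesis
    unfolding top using off diag unfolding q_def N_def by blast
qed

end
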